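(* For every $\gamma$ with $1<\gamma<\frac{\sqrt2}{\sqrt2-1}$ there exist a domain $\mathcal X$ and a class $\mathcal P=\{p_0,p_1\}$ of two distinct distributions on $\mathcal X$ which is not $\gamma$-robustly testable with respect to the squared Hellinger distance $H^2$.
   Context: Distributions. The domain $\mathcal X$ is either a discrete (countable) set, in which case a distribution on $\mathcal X$ means a probability mass function, or $\mathcal X=\mathbb R^d$, in which case a distribution means a probability density with respect to Lebesgue measure. Let $\Delta(\mathcal X)$ be the set of all such distributions. Integrals are read as sums in the discrete case. Squared Hellinger distance: $H^2(p,q)=\frac12\int_{\mathcal X}\left(\sqrt{p(x)}-\sqrt{q(x)}\right)^2dx=1-\int_{\mathcal X}\sqrt{p(x)q(x)}\,dx$. Robust testability. Let $\mathcal P=\{p_0,p_1\}$ with $p_0\neq p_1$ in $\Delta(\mathcal X)$ and let $\gamma>1$. For a target distribution $p\in\Delta(\mathcal X)$ consider the hypotheses $$H_0:\ \gamma H^2(p,p_0)\le H^2(p,p_1),\qquad H_1:\ H^2(p,p_0)\ge\gamma H^2(p,p_1).$$ A (possibly randomized) test is a family of measurable maps $T_m:\mathcal X^m\to[0,1]$, $m\ge1$, where $T_m(x_1,\dots,x_m)$ is the probability of outputting $p_1$ (otherwise $p_0$ is output) upon observing $x_1,\dots,x_m$. The class $\mathcal P$ is $\gamma$-robustly testable (with respect to $H^2$) if there is a test such that for every $\delta>0$ there is a finite $m(\delta)$ such that for every target distribution $p\in\Delta(\mathcal X)$ satisfying $H_0$ or $H_1$, and every $m\ge m(\delta)$, the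 test given $m$ i.i.d. samples from $p$ outputs the element $q$ of $\mathcal P$ minimizing $H^2(q,p)$ (that is, $p_0$ under $H_0$ and $p_1$ under $H_1$) with probability at least $1-\delta$. The bound $m(\delta)$ may depend on $\mathcal P$ and $\gamma$ but not on $p$. *)

theory Defs
  imports "HOL-Probability.Probability"
begin

text \<open>
  A domain is given by its reference measure: counting measure on a countable set, or Lebesgue
  measure on the Borel sets of \<open>\<real>\<^sup>d\<close>. So that a statement can quantify over all domains, in
  particular over the dimension \<open>d\<close>, all of them live on the one carrier type \<^typ>\<open>nat \<Rightarrow> real\<close>:
  a point of \<open>\<real>\<^sup>d\<close> is its coordinate function on \<open>{..<d}\<close> (extensional, that is
  \<^const>\<open>undefined\<close> elsewhere), and every countable set is in bijection with a set of this type.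
\<close>

definition is_domain :: "(nat \<Rightarrow> real) measure \<Rightarrow> bool" where
  "is_domain M \<longleftrightarrow>
     (\<exists>X. countable X \<and> M = count_space X) \<or>
     (\<exists>d\<ge>1. M = (\<Pi>\<^sub>M i\<in>{..<d}. lborel))"

text \<open>
  Probability mass functions if the reference measure is a counting measure, and probability
  densities if it is Lebesgue measure.
\<close>

definition distributions :: "'a measure \<Rightarrow> ('a \<Rightarrow> real) set" where
  "distributions M =
     {p. (\<forall>x\<in>space M. 0 \<le> p x) \<and> integrable M p \<and> (\<integral>x. p x \<partial>M) = 1}"

text \<open>
  Distributions are identified when they agree almost everywhere; for a counting measure this
  is equality at every point of the space.
\<close>

definition distinct_distributions :: "'a measure \<Rightarrow> ('a \<Rightarrow> real) \<Rightarrow> ('a \<Rightarrow> real) \<Rightarrow> bool" where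
  "distinct_distributions M p q \<longleftrightarrow> \<not> (AE x in M. p x = q x)"

definition hellinger_sq :: "'a measure \<Rightarrow> ('a \<Rightarrow> real) \<Rightarrow> ('a \<Rightarrow> real) \<Rightarrow> real" where
  "hellinger_sq M p q = 1 / 2 * (\<integral>x. (sqrt (p x) - sqrt (q x))\<^sup>2 \<partial>M)"

definition iid_samples :: "'a measure \<Rightarrow> ('a \<Rightarrow> real) \<Rightarrow> nat \<Rightarrow> (nat \<Rightarrow> 'a) measure" where
  "iid_samples M p m = (\<Pi>\<^sub>M i\<in>{..<m}. density M (\<lambda>x. ennreal (p x)))"

text \<open>
  \<open>T m x\<close> is the probability with which the randomized test outputs the second hypothesis
  upon observing the sample \<open>x 0, \<dots>, x (m - 1)\<close>.
\<close>

definition randomized_test :: "'a measure \<Rightarrow> (nat \<Rightarrow> (nat \<Rightarrow> 'a) \<Rightarrow> real) \<Rightarrow> bool" where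
  "randomized_test M T \<longleftrightarrow>
     (\<forall>m\<ge>1. T m \<in> borel_measurable (\<Pi>\<^sub>M i\<in>{..<m}. M) \<and>
       (\<forall>x\<in>space (\<Pi>\<^sub>M i\<in>{..<m}. M). 0 \<le> T m x \<and> T m x \<le> 1))"

definition prob_output_first ::
    "'a measure \<Rightarrow> (nat \<Rightarrow> (nat \<Rightarrow> 'a) \<Rightarrow> real) \<Rightarrow> ('a \<Rightarrow> real) \<Rightarrow> nat \<Rightarrow> real" where
  "prob_output_first M T p m = (\<integral>x. 1 - T m x \<partial>iid_samples M p m)"

definition prob_output_second ::
    "'a measure \<Rightarrow> (nat \<Rightarrow> (nat \<Rightarrow> 'a) \<Rightarrow> real) \<Rightarrow> ('a \<Rightarrow> real) \<Rightarrow> nat \<Rightarrow> real" where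
  "prob_output_second M T p m = (\<integral>x. T m x \<partial>iid_samples M p m)"

text \<open>
  For \<open>\<gamma> > 1\<close> and distinct \<open>p0\<close>, \<open>p1\<close>, no target \<open>p\<close> satisfies both hypotheses, so
  the two requirements on the output never conflict. The bound \<open>m0\<close> is chosen before \<open>p\<close>.
\<close>

definition robustly_testable ::
    "'a measure \<Rightarrow> real \<Rightarrow> ('a \<Rightarrow> real) \<Rightarrow> ('a \<Rightarrow> real) \<Rightarrow> bool" where
  "robustly_testable M \<gamma> p0 p1 \<longleftrightarrow>
     (\<exists>T. randomized_test M T \<and>
       (\<forall>\<delta>>0. \<exists>m0\<ge>1. \<forall>p\<in>distributions M. \<forall>m\<ge>m0.
         (\<gamma> * hellinger_sq M p p0 \<le> hellinger_sq M p p1 \<longrightarrow>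
            prob_output_first M T p m \<ge> 1 - \<delta>) \<and>
         (hellinger_sq M p p0 \<ge> \<gamma> * hellinger_sq M p p1 \<longrightarrow>
            prob_output_second M T p m \<ge> 1 - \<delta>)))"

end

theory Submission imports Defs
begin

text \<open>
  Let \<open>p\<^sub>0\<close> and \<open>p\<^sub>1\<close> be uniform on \<open>[0, 1)\<close> and \<open>[1, 2)\<close>. A target near one of them has density
  \<open>1 / 2\<close> on the corresponding half; the other half is cut into \<open>n\<close> blocks of \<open>k\<close> cells each, and
  in every block the mass is concentrated on a single cell chosen by a function \<open>f\<close>.
  Its distance to the near hypothesis is \<open>1 - 1 / sqrt 2\<close> and to the far one
  \<open>1 - 1 / sqrt (2 * k)\<close>, so the promise holds for every \<open>\<gamma>\<close> below the threshold once \<open>k\<close> is large.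
  Averaged over \<open>f\<close>, the density of \<open>m\<close> samples coincides with that of \<open>m\<close> uniform samples from
  \<open>[0, 2)\<close> wherever the samples lie in distinct blocks, whichever half is near. For \<open>n\<close> large compared
  with \<open>m\<^sup>2\<close> collisions are unlikely, so no test can err with small probability on both families.
\<close>

section \<open>Densities of i.i.d. samples\<close>

lemma prob_space_density_distributions:
  assumes "p \<in> distributions M"
  shows "prob_space (density M (\<lambda>x. ennreal (p x)))"
proof -
  have int: "integrable M p" and nn: "\<And>x. x \<in> space M \<Longrightarrow> 0 \<le> p x" and one: "(\<integral>x. p x \<partial>M) = 1"
    using assms by (auto simp: distributions_def)
  have [measurable]: "p \<in> borel_measurable M" using int by auto
  have "(\<integral>\<^sup>+x. ennreal (p x) \<partial>M) = ennreal (\<integral>x. p x \<partial>M)"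
    using nn by (intro nn_integral_eq_integral int) auto
  then show ?thesis
    by (intro prob_spaceI) (simp add: emeasure_density one cong: nn_integral_cong)
qed

lemma sets_iid_samples: "sets (iid_samples M p m) = sets (\<Pi>\<^sub>M i\<in>{..<m}. M)"
  unfolding iid_samples_def by (intro sets_PiM_cong) auto

lemma prob_space_iid_samples:
  "p \<in> distributions M \<Longrightarrow> prob_space (iid_samples M p m)"
  unfolding iid_samples_def by (intro prob_space_PiM prob_space_density_distributions)

text \<open>Both measures agree on boxes, where the integral of a product factorises. With all
  sample laws written as densities against one common product measure, mixtures of them can be
  compared pointwise.\<close>

lemma iid_samples_eq_density:
  assumes M: "sigma_finite_measure M" and p: "p \<in> distributions M"
  shows "iid_samples M p m = density (\<Pi>\<^sub>M i\<in>{..<m}. M) (\<lambda>x. \<Prod>i<m. ennreal (p (x i)))"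
proof -
  interpret M: sigma_finite_measure M by fact
  interpret P: product_sigma_finite "\<lambda>_::nat. M" by standard
  have [measurable]: "p \<in> borel_measurable M"
    using p by (auto simp: distributions_def)
  interpret D: prob_space "density M (\<lambda>x. ennreal (p x))"
    using p by (rule prob_space_density_distributions)
  interpret Q: product_sigma_finite "\<lambda>_::nat. density M (\<lambda>x. ennreal (p x))" by standard
  let ?D = "density (\<Pi>\<^sub>M i\<in>{..<m}. M) (\<lambda>x. \<Prod>i<m. ennreal (p (x i)))"
  have "?D = (\<Pi>\<^sub>M i\<in>{..<m}. density M (\<lambda>x. ennreal (p x)))"
  proof (rule Q.PiM_eqI)
    show "sets ?D = sets (\<Pi>\<^sub>M i\<in>{..<m}. density M (\<lambda>x. ennreal (p x)))"
      by (simp only: sets_density sets_iid_samples[unfolded iid_samples_def])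
  next
    fix A assume "\<And>i. i \<in> {..<m} \<Longrightarrow> A i \<in> sets (density M (\<lambda>x. ennreal (p x)))"
    then have A [measurable]: "\<And>i. i \<in> {..<m} \<Longrightarrow> A i \<in> sets M" by simp
    have PA: "Pi\<^sub>E {..<m} A \<in> sets (\<Pi>\<^sub>M i\<in>{..<m}. M)"
      using A by (intro sets_PiM_I_finite) auto
    have ind: "indicator (Pi\<^sub>E {..<m} A) x = (\<Prod>i<m. indicator (A i) (x i) :: ennreal)"
      if "x \<in> space (\<Pi>\<^sub>M i\<in>{..<m}. M)" for x
      using that by (auto simp: indicator_def space_PiM PiE_iff)
    have "emeasure ?D (Pi\<^sub>E {..<m} A)
        = (\<integral>\<^sup>+x. (\<Prod>i<m. ennreal (p (x i))) * indicator (Pi\<^sub>E {..<m} A) x \<partial>(\<Pi>\<^sub>M i\<in>{..<m}. M))"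
      using PA by (subst emeasure_density) auto
    also have "\<dots> = (\<integral>\<^sup>+x. (\<Prod>i<m. ennreal (p (x i)) * indicator (A i) (x i)) \<partial>(\<Pi>\<^sub>M i\<in>{..<m}. M))"
      by (intro nn_integral_cong) (simp add: ind prod.distrib)
    also have "\<dots> = (\<Prod>i<m. \<integral>\<^sup>+x. ennreal (p x) * indicator (A i) x \<partial>M)"
      using A by (intro P.product_nn_integral_prod) auto
    also have "\<dots> = (\<Prod>i<m. emeasure (density M (\<lambda>x. ennreal (p x))) (A i))"
      using A by (intro prod.cong) (auto simp: emeasure_density)
    finally show "emeasure ?D (Pi\<^sub>E {..<m} A) = (\<Prod>i<m. emeasure (density M (\<lambda>x. ennreal (p x))) (A i))" .
  qed simp
  then show ?thesis by (simp add: iid_samples_def)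
qed

text \<open>Injectivity of \<open>b\<close> makes the factors read different coordinates of
  \<open>f\<close>, so the sum factorises. Each of the \<open>card J - card I\<close> coordinates
  that no factor reads contributes a free choice from \<open>C\<close>.\<close>

lemma sum_PiE_prod_inj:
  fixes h :: "'i \<Rightarrow> 'c \<Rightarrow> real" and b :: "'i \<Rightarrow> 'j"
  assumes "finite J" "finite C" "inj_on b I" "b ` I \<subseteq> J"
  shows "(\<Sum>f\<in>PiE J (\<lambda>_. C). \<Prod>i\<in>I. h i (f (b i)))
       = (\<Prod>i\<in>I. \<Sum>c\<in>C. h i c) * real (card C) ^ (card J - card I)"
proof -
  \<comment> \<open>Reindexes the factors by coordinates in \<open>J\<close>, with the value 1 at
    coordinates that are not read, so that \<open>prod_sum_PiE\<close> applies.\<close>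
  define g where "g j c = (if j \<in> b ` I then h (the_inv_into I b j) c else 1)" for j c
  have gb: "g (b i) c = h i c" if "i \<in> I" for i c
    using that assms by (simp add: g_def the_inv_into_f_f)
  have split: "(\<Prod>j\<in>J. G j) = (\<Prod>i\<in>I. G (b i)) * (\<Prod>j\<in>J - b ` I. G j)" for G :: "'j \<Rightarrow> real"
    using assms by (subst prod.subset_diff[of "b ` I" J]) (auto simp: prod.reindex mult.commute)
  have "(\<Sum>f\<in>PiE J (\<lambda>_. C). \<Prod>i\<in>I. h i (f (b i))) = (\<Sum>f\<in>PiE J (\<lambda>_. C). \<Prod>j\<in>J. g j (f j))"
    by (intro sum.cong refl) (simp add: split gb, simp add: g_def)
  also have "\<dots> = (\<Prod>j\<in>J. \<Sum>c\<in>C. g j c)"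
    using assms by (subst prod_sum_PiE) auto
  also have "\<dots> = (\<Prod>i\<in>I. \<Sum>c\<in>C. h i c) * (\<Prod>j\<in>J - b ` I. real (card C))"
    by (simp add: split gb, simp add: g_def)
  also have "(\<Prod>j\<in>J - b ` I. real (card C)) = real (card C) ^ (card J - card I)"
    using assms by (simp add: card_Diff_subset finite_subset card_image)
  finally show ?thesis .
qed

section \<open>Step functions on the real line\<close>

text \<open>The case \<open>d = 1\<close> of the Lebesgue domains, since \<open>{..<1}\<close> is
  \<open>{0}\<close>.\<close>

definition line :: "(nat \<Rightarrow> real) measure" where
  "line = (\<Pi>\<^sub>M i\<in>{0}. lborel)"

text \<open>Here \<open>nat\<close> sends negative floors to 0, which is why the lemmas about cells
  assume a nonnegative coordinate.\<close>

definition cell :: "nat \<Rightarrow> (nat \<Rightarrow> real) \<Rightarrow> nat" where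
  "cell N x = nat \<lfloor>real N * x 0\<rfloor>"

text \<open>Every density in the construction has this form, which turns integrals and Hellinger
  distances into finite sums over the \<open>2 * N\<close> cells of \<open>[0, 2)\<close>.\<close>

definition step :: "nat \<Rightarrow> (nat \<Rightarrow> real) \<Rightarrow> (nat \<Rightarrow> real) \<Rightarrow> real" where
  "step N \<phi> x = (if 0 \<le> x 0 \<and> x 0 < 2 then \<phi> (cell N x) else 0)"

lemma sigma_finite_line: "sigma_finite_measure line"
proof -
  interpret product_sigma_finite "\<lambda>_::nat. lborel :: real measure" by standard
  show ?thesis unfolding line_def by (intro sigma_finite) simp
qed

lemma measurable_component_line [measurable]: "(\<lambda>x. x 0) \<in> borel_measurable line"
  unfolding line_def by measurable

lemma measurable_cell [measurable]: "cell N \<in> measurable line (count_space UNIV)"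
proof -
  have "(\<lambda>t. nat \<lfloor>real N * t\<rfloor>) \<in> measurable borel (count_space UNIV)" by measurable
  from measurable_compose[OF measurable_component_line this] show ?thesis
    by (simp add: cell_def[abs_def])
qed

lemma measurable_step [measurable]: "step N \<phi> \<in> borel_measurable line"
proof -
  have "(\<lambda>t. nat \<lfloor>real N * t\<rfloor>) \<in> measurable borel (count_space UNIV)" by measurable
  then have [measurable]: "(\<lambda>t. \<phi> (nat \<lfloor>real N * t\<rfloor>)) \<in> borel_measurable borel"
    by (rule measurable_compose) simp
  have "(\<lambda>t. if 0 \<le> t \<and> t < 2 then \<phi> (nat \<lfloor>real N * t\<rfloor>) else 0) \<in> borel_measurable borel"
    by measurable
  from measurable_compose[OF measurable_component_line this] show ?thesis
    unfolding step_def[abs_def] cell_def .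
qed

lemma cell_eq_iff:
  assumes "0 < N" "0 \<le> x 0"
  shows "cell N x = l \<longleftrightarrow> real l / real N \<le> x 0 \<and> x 0 < real (Suc l) / real N"
proof -
  have "cell N x = l \<longleftrightarrow> \<lfloor>real N * x 0\<rfloor> = int l"
    using assms by (auto simp: cell_def nat_eq_iff)
  also have "\<dots> \<longleftrightarrow> real l \<le> real N * x 0 \<and> real N * x 0 < real l + 1"
    by (simp add: floor_eq_iff)
  finally show ?thesis using assms by (simp add: field_simps)
qed

lemma cell_less_iff:
  assumes "0 < N" "0 \<le> x 0"
  shows "cell N x < a * N \<longleftrightarrow> x 0 < real a"
proof -
  have "cell N x < a * N \<longleftrightarrow> \<lfloor>real N * x 0\<rfloor> < int (a * N)"
    using assms unfolding cell_def
    by (metis nat_less_iff mult_nonneg_nonneg of_nat_0_le_iff zero_le_floor)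
  also have "\<dots> \<longleftrightarrow> real N * x 0 < real (a * N)"
    by (simp add: floor_less_iff)
  finally show ?thesis using assms by (simp add: field_simps)
qed

lemma step_eq_sum:
  assumes "0 < N"
  shows "step N \<phi> x = (\<Sum>l<2*N. \<phi> l * indicator {real l / real N..<real (Suc l) / real N} (x 0))"
proof (cases "0 \<le> x 0")
  case True
  have "(\<Sum>l<2*N. \<phi> l * indicator {real l / real N..<real (Suc l) / real N} (x 0))
      = (\<Sum>l<2*N. if l = cell N x then \<phi> l else 0)"
    using assms True cell_eq_iff[of N x, symmetric] by (intro sum.cong) (auto simp: indicator_def)
  also have "\<dots> = step N \<phi> x"
    using assms True cell_less_iff[of N x 2] by (auto simp: step_def)
  finally show ?thesis ..
next
  case False
  have "\<not> real l / real N \<le> x 0" for l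
    using False by (smt (verit) divide_nonneg_nonneg of_nat_0_le_iff)
  with False show ?thesis by (auto simp: step_def indicator_def)
qed

text \<open>Projection to the single coordinate carries \<open>line\<close> to
  \<open>lborel\<close>, and each of the cells there has length \<open>1 / N\<close>.\<close>

lemma has_bochner_integral_step:
  assumes "0 < N"
  shows "has_bochner_integral line (step N \<phi>) ((\<Sum>l<2*N. \<phi> l) / real N)"
proof -
  interpret product_sigma_finite "\<lambda>_::nat. lborel :: real measure" by standard
  define g where "g t = (\<Sum>l<2*N. \<phi> l * indicator {real l / real N..<real (Suc l) / real N} t)" for t :: real
  have g: "has_bochner_integral lborel g (\<Sum>l<2*N. \<phi> l * (real (Suc l) / real N - real l / real N))"
    unfolding g_def using assms
    by (intro has_bochner_integral_sum has_bochner_integral_mult_right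
          has_bochner_integral_real_indicator[THEN has_bochner_integral_cong[THEN iffD1, rotated -1]])
       (auto simp: divide_right_mono measure_def)
  have "has_bochner_integral (distr line lborel (\<lambda>x. x 0)) g ((\<Sum>l<2*N. \<phi> l) / real N)"
    using g unfolding line_def distr_singleton
    by (simp add: diff_divide_distrib[symmetric] sum_divide_distrib)
  moreover have "step N \<phi> = (\<lambda>x. g (x 0))"
    using assms by (simp add: step_eq_sum g_def fun_eq_iff)
  moreover have [measurable]: "g \<in> borel_measurable borel" unfolding g_def by measurable
  ultimately show ?thesis
    by (simp add: has_bochner_integral_iff integrable_distr_eq integral_distr)
qed

lemma step_in_distributions:
  assumes "0 < N" "\<And>l. 0 \<le> \<phi> l" "(\<Sum>l<2*N. \<phi> l) = real N"
  shows "step N \<phi> \<in> distributions line"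
  using has_bochner_integral_step[OF assms(1), of \<phi>] assms
  by (auto simp: distributions_def has_bochner_integral_iff step_def)

lemma hellinger_sq_step:
  assumes "0 < N"
  shows "hellinger_sq line (step N \<phi>) (step N \<psi>)
       = (\<Sum>l<2*N. (sqrt (\<phi> l) - sqrt (\<psi> l))\<^sup>2) / (2 * real N)"
proof -
  have "(\<lambda>x. (sqrt (step N \<phi> x) - sqrt (step N \<psi> x))\<^sup>2) = step N (\<lambda>l. (sqrt (\<phi> l) - sqrt (\<psi> l))\<^sup>2)"
    by (auto simp: step_def)
  with has_bochner_integral_step[OF assms] show ?thesis
    by (simp add: hellinger_sq_def has_bochner_integral_iff)
qed

lemma sum_blocks:
  "(\<Sum>l<n * k. F (l div k) (l mod k)) = (\<Sum>j<n. \<Sum>c<k. F j c)" for k :: nat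
proof -
  have dm: "l div k = j \<and> l mod k = l - j * k" if "j * k \<le> l" "l < j * k + k" for j l
  proof -
    have "l div k = j" using that by (intro div_nat_eqI) (auto simp: mult.commute)
    then show ?thesis using minus_div_mult_eq_mod[of l k] by simp
  qed
  have "(\<Sum>l\<in>{j * k..<j * k + k}. F (l div k) (l mod k)) = (\<Sum>c<k. F j c)" for j
    by (rule sum.reindex_bij_witness[of _ "\<lambda>c. j * k + c" "\<lambda>l. l - j * k"]) (use dm in auto)
  then show ?thesis by (simp flip: sum.nat_group)
qed

text \<open>Identifies the block of a point with its cell at the coarser resolution
  \<open>n\<close>, so that collisions can be stated without reference to \<open>k\<close>.\<close>

lemma cell_div:
  assumes "0 < k" "0 \<le> x 0"
  shows "cell (n * k) x div k = cell n x"
proof -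
  have "\<lfloor>real n * x 0\<rfloor> = \<lfloor>real (n * k) * x 0 / real_of_int (int k)\<rfloor>"
    using assms by simp
  also have "\<dots> = \<lfloor>real (n * k) * x 0\<rfloor> div int k"
    by (rule floor_divide_real_eq_div) simp
  finally show ?thesis
    using assms by (simp add: cell_def nat_div_distrib)
qed

lemma nn_integral_step:
  assumes "0 < N" "\<And>l. 0 \<le> \<phi> l"
  shows "(\<integral>\<^sup>+x. ennreal (step N \<phi> x) \<partial>line) = ennreal ((\<Sum>l<2*N. \<phi> l) / real N)"
  using has_bochner_integral_step[OF assms(1), of \<phi>] assms(2)
  by (subst nn_integral_eq_integral) (auto simp: has_bochner_integral_iff step_def)

section \<open>The two hypotheses, the sparse targets and their distances\<close>

definition half :: "bool \<Rightarrow> (nat \<Rightarrow> real) \<Rightarrow> real" where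
  "half i x = (if 0 \<le> x 0 \<and> x 0 < 2 \<and> (x 0 < 1 \<longleftrightarrow> i) then 1 else 0)"

definition unif :: "(nat \<Rightarrow> real) \<Rightarrow> real" where
  "unif x = (if 0 \<le> x 0 \<and> x 0 < 2 then 1 / 2 else 0)"

text \<open>
  With \<open>n * k\<close> cells per unit length, cell \<open>l\<close> is the cell number \<open>l mod k\<close> of the block \<open>l div k\<close>.
\<close>

definition sparse :: "nat \<Rightarrow> nat \<Rightarrow> bool \<Rightarrow> (nat \<Rightarrow> nat) \<Rightarrow> nat \<Rightarrow> real" where
  "sparse n k i f l =
     (if l div k < n \<longleftrightarrow> i then 1 / 2 else if l mod k = f (l div k) then real k / 2 else 0)"

lemma unif_eq_step: "unif = step N (\<lambda>_. 1 / 2)"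
  by (auto simp: unif_def step_def)

lemma half_eq_step:
  assumes "0 < n" "0 < k"
  shows "half i = step (n * k) (\<lambda>l. if l div k < n \<longleftrightarrow> i then 1 else 0)"
  using assms cell_less_iff[of n _ 1] by (auto simp: fun_eq_iff half_def step_def cell_div)

text \<open>Each half consists of \<open>n\<close> blocks, so the total does not depend on which
  half is the near one.\<close>

lemma sum_halves:
  "(\<Sum>j<2 * n. if j < n \<longleftrightarrow> i then A else B) = real n * (A + B)"
proof -
  have "(\<Sum>j<2 * n. if j < n \<longleftrightarrow> i then A else B)
      = (\<Sum>j<n. if i then A else B) + (\<Sum>j\<in>{n..<2*n}. if i then B else A)"
    by (subst ivl_disj_un_one(2)[of n "2 * n", symmetric], simp, subst sum.union_disjoint)
       (auto intro!: arg_cong2[of _ _ _ _ "(+)"] sum.cong)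
  then show ?thesis by (simp add: algebra_simps)
qed

lemma sum_delta_split:
  fixes a b :: real
  assumes "c0 < k"
  shows "(\<Sum>c<k. if c = c0 then a else b) = a + (real k - 1) * b"
  using assms by (simp add: sum.remove[of "{..<k}" c0] of_nat_diff)

lemma sum_if_const:
  "(\<Sum>c<k. if P then a else g c) = (if P then real k * a else (\<Sum>c<k. g c))"
  by simp

text \<open>In every block the values sum to \<open>k / 2\<close>: either \<open>k\<close> cells of
  value \<open>1 / 2\<close> or one cell of value \<open>k / 2\<close>. Hence the total mass does
  not depend on \<open>f\<close>.\<close>

lemma sparse_in_distributions:
  assumes "0 < n" "0 < k" "f \<in> {..<2 * n} \<rightarrow>\<^sub>E {..<k}"
  shows "step (n * k) (sparse n k i f) \<in> distributions line"
proof (rule step_in_distributions)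
  have "(\<Sum>l<2 * (n * k). sparse n k i f l)
      = (\<Sum>j<2 * n. \<Sum>c<k. if j < n \<longleftrightarrow> i then 1 / 2 else if c = f j then real k / 2 else 0)"
    unfolding sparse_def
    by (subst mult.assoc[symmetric], subst sum_blocks[symmetric]) simp
  also have "\<dots> = (\<Sum>j<2 * n. if j < n \<longleftrightarrow> i then real k / 2 else real k / 2)"
    using assms by (intro sum.cong refl) (auto simp: sum_if_const sum_delta_split PiE_iff)
  finally show "(\<Sum>l<2 * (n * k). sparse n k i f l) = real (n * k)" by simp
qed (use assms in \<open>auto simp: sparse_def\<close>)

text \<open>The subtracted terms are the affinities. On the near half the integrand is
  \<open>sqrt (1 / 2)\<close> throughout; on the far half it is \<open>sqrt (k / 2)\<close> on a
  fraction \<open>1 / k\<close> of the cells.\<close>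

lemma hellinger_sq_sparse:
  assumes "0 < n" "0 < k" and f: "f \<in> {..<2 * n} \<rightarrow>\<^sub>E {..<k}"
  shows "hellinger_sq line (step (n * k) (sparse n k i f)) (half i) = 1 - 1 / sqrt 2" (is ?same)
    and "hellinger_sq line (step (n * k) (sparse n k i f)) (half (\<not> i)) = 1 - 1 / sqrt (2 * real k)" (is ?other)
proof -
  \<comment> \<open>The numbers \<open>e\<close> and \<open>e'\<close> are the values of
    \<open>half i'\<close> on the near and on the far half of the target; being 0 or 1, they equal
    their square roots.\<close>
  have *: "hellinger_sq line (step (n * k) (sparse n k i f)) (half i')
      = (real k * (sqrt (1 / 2) - e)\<^sup>2 + ((sqrt (real k / 2) - e')\<^sup>2 + (real k - 1) * e'\<^sup>2)) / (2 * real k)"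
    if e: "e = of_bool (i = i')" "e' = of_bool (i \<noteq> i')" for i' and e e' :: real
  proof -
    have "(\<Sum>l<2 * (n * k). (sqrt (sparse n k i f l) - sqrt (if l div k < n \<longleftrightarrow> i' then 1 else 0))\<^sup>2)
      = (\<Sum>j<2 * n. \<Sum>c<k. if j < n \<longleftrightarrow> i then (sqrt (1 / 2) - e)\<^sup>2
            else if c = f j then (sqrt (real k / 2) - e')\<^sup>2 else e'\<^sup>2)"
      unfolding sparse_def e
      by (subst mult.assoc[symmetric], subst sum_blocks[symmetric], intro sum.cong refl) auto
    also have "\<dots> = (\<Sum>j<2 * n. if j < n \<longleftrightarrow> i then real k * (sqrt (1 / 2) - e)\<^sup>2
            else (sqrt (real k / 2) - e')\<^sup>2 + (real k - 1) * e'\<^sup>2)"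
      using f by (intro sum.cong refl) (auto simp: sum_delta_split PiE_iff)
    also have "\<dots> = real n * (real k * (sqrt (1 / 2) - e)\<^sup>2 + ((sqrt (real k / 2) - e')\<^sup>2 + (real k - 1) * e'\<^sup>2))"
      by (rule sum_halves)
    finally show ?thesis
      using assms by (subst half_eq_step[OF assms(1,2)], subst hellinger_sq_step) auto
  qed
  show ?same
    using assms by (subst *[OF refl refl]) (simp add: real_sqrt_divide power2_diff field_simps)
  have "sqrt (2 * real k) * sqrt (real k / 2) = real k"
    by (simp flip: real_sqrt_mult)
  then show ?other
    using assms by (subst *[OF refl refl]) (simp add: power2_diff real_sqrt_divide real_sqrt_mult field_simps)
qed

section \<open>Collisions of uniform samples\<close>

definition collide :: "nat \<Rightarrow> nat \<Rightarrow> (nat \<Rightarrow> nat \<Rightarrow> real) set" where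
  "collide n m = {x. \<not> inj_on (\<lambda>i. cell n (x i)) {..<m}}"

lemma measurable_cell_component [measurable]:
  "i < m \<Longrightarrow> (\<lambda>x. cell n (x i)) \<in> measurable (\<Pi>\<^sub>M i\<in>{..<m}. line) (count_space UNIV)"
  using measurable_compose[OF measurable_component_singleton[of i "{..<m}" "\<lambda>_. line"] measurable_cell, of n] by simp

lemma measurable_collide [measurable]:
  "Measurable.pred (\<Pi>\<^sub>M i\<in>{..<m}. line) (\<lambda>x. x \<in> collide n m)"
  unfolding collide_def inj_on_def mem_Collect_eq by measurable

lemma measurable_indicator_collide [measurable]:
  "(indicator (collide n m) :: _ \<Rightarrow> ennreal) \<in> borel_measurable (\<Pi>\<^sub>M i\<in>{..<m}. line)"
  "(indicator (- collide n m) :: _ \<Rightarrow> ennreal) \<in> borel_measurable (\<Pi>\<^sub>M i\<in>{..<m}. line)"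
  unfolding indicator_def[abs_def] Compl_iff by measurable

text \<open>A union bound: two given samples share a given block with probability
  \<open>1 / (2 * n)^2\<close>, there are \<open>2 * n\<close> blocks, and at most
  \<open>m\<^sup>2\<close> ordered pairs.\<close>

lemma nn_integral_collide_le:
  assumes n: "0 < n"
  shows "(\<integral>\<^sup>+x. (\<Prod>l<m. ennreal (unif (x l))) * indicator (collide n m) x \<partial>(\<Pi>\<^sub>M i\<in>{..<m}. line))
       \<le> ennreal (real (m\<^sup>2) / real (2 * n))"
proof -
  interpret sigma_finite_measure line by (rule sigma_finite_line)
  interpret product_sigma_finite "\<lambda>_::nat. line" by standard
  define E where "E = {(i, j). i < m \<and> j < m \<and> i \<noteq> j}"
  have E: "finite E" "card E \<le> m\<^sup>2"
  proof -
    have "E \<subseteq> {..<m} \<times> {..<m}" by (auto simp: E_def)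
    from card_mono[OF _ this] finite_subset[OF this] show "finite E" "card E \<le> m\<^sup>2"
      by (auto simp: power2_eq_square)
  qed
  \<comment> \<open>The uniform density, cut down to block \<open>b\<close> for the samples
    \<open>i\<close> and \<open>j\<close> only. The product over \<open>l\<close> then has
    independent factors and its integral factorises.\<close>
  define g where "g i j b l = step n (\<lambda>c. if l \<in> {i, j} then (if c = b then 1 / 2 else 0) else 1 / 2)" for i j b l :: nat
  have [measurable]: "g i j b l \<in> borel_measurable line" for i j b l
    by (simp add: g_def)
  have le: "(\<Prod>l<m. ennreal (unif (x l))) * indicator (collide n m) x
      \<le> (\<Sum>(i, j)\<in>E. \<Sum>b<2 * n. \<Prod>l<m. ennreal (g i j b l (x l)))" (is "?L \<le> ?R") for x
  proof (cases "x \<in> collide n m \<and> (\<forall>l<m. 0 \<le> x l 0 \<and> x l 0 < 2)")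
    case True
    then obtain i j where ij: "(i, j) \<in> E" and eq: "cell n (x i) = cell n (x j)"
      by (auto simp: collide_def inj_on_def E_def)
    have b: "cell n (x i) < 2 * n"
      using True ij n cell_less_iff[of n "x i" 2] by (auto simp: E_def)
    have "?L = (\<Prod>l<m. ennreal (unif (x l)))"
      using True by simp
    also have "\<dots> = (\<Prod>l<m. ennreal (g i j (cell n (x i)) l (x l)))"
      using True eq by (intro prod.cong refl) (auto simp: g_def unif_def step_def)
    also have "\<dots> \<le> (\<Sum>b<2 * n. \<Prod>l<m. ennreal (g i j b l (x l)))"
      using b by (intro member_le_sum) auto
    also have "\<dots> \<le> ?R"
      using ij E by (intro member_le_sum[of "(i, j)" E "\<lambda>(i, j). \<Sum>b<2 * n. \<Prod>l<m. ennreal (g i j b l (x l))", simplified]) auto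
    finally show ?thesis .
  next
    case False
    then have L: "?L = 0" by (auto simp: unif_def indicator_def not_le not_less intro!: prod_zero)
    show ?thesis unfolding L by simp
  qed
  have "(\<integral>\<^sup>+x. (\<Prod>l<m. ennreal (unif (x l))) * indicator (collide n m) x \<partial>(\<Pi>\<^sub>M i\<in>{..<m}. line))
      \<le> (\<integral>\<^sup>+x. (\<Sum>(i, j)\<in>E. \<Sum>b<2 * n. \<Prod>l<m. ennreal (g i j b l (x l))) \<partial>(\<Pi>\<^sub>M i\<in>{..<m}. line))"
    by (intro nn_integral_mono le)
  also have "\<dots> = (\<Sum>(i, j)\<in>E. \<Sum>b<2 * n. \<integral>\<^sup>+x. (\<Prod>l<m. ennreal (g i j b l (x l))) \<partial>(\<Pi>\<^sub>M i\<in>{..<m}. line))"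
    by (simp add: case_prod_unfold nn_integral_sum)
  also have "\<dots> = (\<Sum>(i, j)\<in>E. \<Sum>b<2 * n. \<Prod>l<m. \<integral>\<^sup>+x. ennreal (g i j b l x) \<partial>line)"
    unfolding case_prod_unfold by (intro sum.cong refl product_nn_integral_prod) auto
  also have "\<dots> = (\<Sum>(i, j)\<in>E. \<Sum>b<2 * n. ennreal (1 / (2 * real n)^2))"
  proof (intro sum.cong refl, clarify, intro sum.cong refl)
    fix i j b assume ij: "(i, j) \<in> E" and b: "b \<in> {..<2 * n}"
    have "(\<integral>\<^sup>+x. ennreal (g i j b l x) \<partial>line) = ennreal (if l \<in> {i, j} then 1 / (2 * real n) else 1)" for l
      using n b unfolding g_def by (subst nn_integral_step) (auto simp: field_simps)
    then have "(\<Prod>l<m. \<integral>\<^sup>+x. ennreal (g i j b l x) \<partial>line)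
        = ennreal (\<Prod>l<m. if l \<in> {i, j} then 1 / (2 * real n) else 1)"
      by (simp only:) (subst prod_ennreal, auto)
    also have "(\<Prod>l<m. if l \<in> {i, j} then 1 / (2 * real n) else 1) = (\<Prod>l\<in>{i, j}. 1 / (2 * real n))"
      using ij by (intro prod.mono_neutral_cong_right) (auto simp: E_def)
    also have "\<dots> = 1 / (2 * real n)^2"
      using ij by (simp add: E_def power2_eq_square)
    finally show "(\<Prod>l<m. \<integral>\<^sup>+x. ennreal (g i j b l x) \<partial>line) = ennreal (1 / (2 * real n)^2)" .
  qed
  also have "\<dots> = ennreal (real (card E) * (real (2 * n) * (1 / (2 * real n)^2)))"
    by (simp add: ennreal_of_nat_eq_real_of_nat del: of_nat_mult flip: ennreal_mult)
  also have "\<dots> = ennreal (real (card E) / real (2 * n))"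
    using n by (simp add: power2_eq_square)
  also have "\<dots> \<le> ennreal (real (m\<^sup>2) / real (2 * n))"
    using E by (intro ennreal_leI divide_right_mono of_nat_mono) auto
  finally show ?thesis .
qed

section \<open>Averaging over the sparse targets\<close>

text \<open>Samples in distinct blocks read distinct coordinates of \<open>f\<close>. Summing over
  one coordinate gives \<open>k / 2\<close> in either half: \<open>k\<close> terms
  \<open>1 / 2\<close>, or a single term \<open>k / 2\<close>. This is why the result does not
  depend on \<open>i\<close>.\<close>

lemma sum_sparse_product:
  assumes "0 < n" "0 < k" and nc: "x \<notin> collide n m" and x: "\<And>l. l < m \<Longrightarrow> 0 \<le> x l 0 \<and> x l 0 < 2"
  shows "(\<Sum>f\<in>{..<2 * n} \<rightarrow>\<^sub>E {..<k}. \<Prod>l<m. step (n * k) (sparse n k i f) (x l))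
       = real k ^ (2 * n) * (\<Prod>l<m. unif (x l))"
proof -
  define h where "h l c = (if cell n (x l) < n \<longleftrightarrow> i then 1 / 2
      else if c = cell (n * k) (x l) mod k then real k / 2 else 0)" for l c
  have inj: "inj_on (\<lambda>l. cell n (x l)) {..<m}"
    using nc by (simp add: collide_def)
  have sub: "(\<lambda>l. cell n (x l)) ` {..<m} \<subseteq> {..<2 * n}"
    using x cell_less_iff[of n _ 2] assms(1) by auto
  \<comment> \<open>Needed because the exponent \<open>2 * n - m\<close> is a truncated
    subtraction.\<close>
  have m: "m \<le> 2 * n"
    using card_inj_on_le[OF inj sub] by simp
  have "(\<Sum>f\<in>{..<2 * n} \<rightarrow>\<^sub>E {..<k}. \<Prod>l<m. step (n * k) (sparse n k i f) (x l))
      = (\<Sum>f\<in>{..<2 * n} \<rightarrow>\<^sub>E {..<k}. \<Prod>l<m. h l (f (cell n (x l))))"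
    using x assms by (intro sum.cong prod.cong refl) (auto simp: step_def sparse_def h_def cell_div)
  also have "\<dots> = (\<Prod>l<m. \<Sum>c<k. h l c) * real k ^ (2 * n - m)"
    using sum_PiE_prod_inj[OF _ _ inj sub, of "{..<k}" h] by simp
  also have "(\<Prod>l<m. \<Sum>c<k. h l c) = (\<Prod>l<m. real k * unif (x l))"
    using x assms by (intro prod.cong refl) (auto simp: h_def unif_def sum_if_const)
  also have "\<dots> * real k ^ (2 * n - m) = real k ^ (2 * n) * (\<Prod>l<m. unif (x l))"
    using m by (simp add: prod.distrib power_add[symmetric])
  finally show ?thesis .
qed

text \<open>A bound valid for every \<open>f\<close> is valid for the average over the
  \<open>k ^ (2 * n)\<close> functions, and the density of that average dominates the collision-free
  part of the uniform one.\<close>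

lemma nn_integral_no_collide_le:
  assumes "0 < n" "0 < k" and [measurable]: "g \<in> borel_measurable (\<Pi>\<^sub>M i\<in>{..<m}. line)"
    and le: "\<And>f. f \<in> {..<2 * n} \<rightarrow>\<^sub>E {..<k} \<Longrightarrow>
      (\<integral>\<^sup>+x. g x \<partial>iid_samples line (step (n * k) (sparse n k i f)) m) \<le> \<delta>"
  shows "(\<integral>\<^sup>+x. (\<Prod>l<m. ennreal (unif (x l))) * indicator (- collide n m) x * g x \<partial>(\<Pi>\<^sub>M i\<in>{..<m}. line)) \<le> \<delta>"
    (is "?I \<le> \<delta>")
proof -
  let ?F = "{..<2 * n} \<rightarrow>\<^sub>E {..<k}"
  let ?q = "\<lambda>f. step (n * k) (sparse n k i f)"
  let ?K = "ennreal (real k ^ (2 * n))"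
  have [measurable]: "unif \<in> borel_measurable line"
    unfolding unif_eq_step[of 1] by simp
  have nn: "0 \<le> ?q f y" for f y by (simp add: step_def sparse_def)
  \<comment> \<open>Without a collision, and with all samples in \<open>[0, 2)\<close>, this is an
    equality; otherwise the left side is 0.\<close>
  have pw: "?K * ((\<Prod>l<m. ennreal (unif (x l))) * indicator (- collide n m) x) \<le> (\<Sum>f\<in>?F. \<Prod>l<m. ennreal (?q f (x l)))" for x
  proof (cases "x \<notin> collide n m \<and> (\<forall>l<m. 0 \<le> x l 0 \<and> x l 0 < 2)")
    case True
    have u: "0 \<le> unif y" for y by (simp add: unif_def)
    have "?K * ((\<Prod>l<m. ennreal (unif (x l))) * indicator (- collide n m) x)
        = ennreal (real k ^ (2 * n)) * ennreal (\<Prod>l<m. unif (x l))"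
      using True u by (simp add: prod_ennreal)
    also have "\<dots> = ennreal (real k ^ (2 * n) * (\<Prod>l<m. unif (x l)))"
      using u by (simp add: ennreal_mult prod_nonneg)
    also have "\<dots> = ennreal (\<Sum>f\<in>?F. \<Prod>l<m. ?q f (x l))"
      using True assms(1,2) by (subst sum_sparse_product) auto
    also have "\<dots> = (\<Sum>f\<in>?F. \<Prod>l<m. ennreal (?q f (x l)))"
      using nn by (subst sum_ennreal[symmetric]) (auto simp: prod_ennreal prod_nonneg)
    finally show ?thesis by simp
  next
    case False
    then have L: "(\<Prod>l<m. ennreal (unif (x l))) * indicator (- collide n m) x = 0"
      by (auto simp: unif_def indicator_def not_le not_less intro!: prod_zero)
    show ?thesis unfolding L by simp
  qed
  have "?K * ?I = (\<integral>\<^sup>+x. ?K * ((\<Prod>l<m. ennreal (unif (x l))) * indicator (- collide n m) x) * g x \<partial>(\<Pi>\<^sub>M i\<in>{..<m}. line))"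
    by (subst nn_integral_cmult[symmetric]) (auto simp: mult.assoc)
  also have "\<dots> \<le> (\<integral>\<^sup>+x. (\<Sum>f\<in>?F. \<Prod>l<m. ennreal (?q f (x l))) * g x \<partial>(\<Pi>\<^sub>M i\<in>{..<m}. line))"
    by (intro nn_integral_mono mult_right_mono pw) auto
  also have "\<dots> = (\<Sum>f\<in>?F. \<integral>\<^sup>+x. (\<Prod>l<m. ennreal (?q f (x l))) * g x \<partial>(\<Pi>\<^sub>M i\<in>{..<m}. line))"
    by (simp add: sum_distrib_right nn_integral_sum)
  also have "\<dots> = (\<Sum>f\<in>?F. \<integral>\<^sup>+x. g x \<partial>iid_samples line (?q f) m)"
    using assms(1,2)
    by (intro sum.cong refl)
       (subst iid_samples_eq_density[OF sigma_finite_line sparse_in_distributions], auto simp: nn_integral_density)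
  also have "\<dots> \<le> (\<Sum>f\<in>?F. \<delta>)"
    by (intro sum_mono le)
  also have "\<dots> = ?K * \<delta>"
    by (simp add: card_PiE ennreal_of_nat_eq_real_of_nat)
  finally show ?thesis
    using assms(2) by (subst (asm) ennreal_mult_le_mult_iff) (auto simp: ennreal_eq_0_iff not_le)
qed

section \<open>Failure of every test\<close>

text \<open>Turns a success guarantee into an error bound. It serves both outputs, with
  \<open>g\<close> being \<open>T m\<close> or \<open>1 - T m\<close>.\<close>

lemma nn_integral_error_le:
  assumes p: "p \<in> distributions M" and g: "g \<in> borel_measurable (\<Pi>\<^sub>M i\<in>{..<m}. M)"
    and g01: "\<And>x. x \<in> space (\<Pi>\<^sub>M i\<in>{..<m}. M) \<Longrightarrow> 0 \<le> g x \<and> g x \<le> 1"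
    and ge: "(\<integral>x. 1 - g x \<partial>iid_samples M p m) \<ge> 1 - \<delta>"
  shows "(\<integral>\<^sup>+x. ennreal (g x) \<partial>iid_samples M p m) \<le> ennreal \<delta>"
proof -
  interpret prob_space "iid_samples M p m" using p by (rule prob_space_iid_samples)
  note sp = sets_eq_imp_space_eq[OF sets_iid_samples[of M p m]]
  have int: "integrable (iid_samples M p m) g"
    using g g01 by (intro integrable_const_bound[where B = 1])
      (auto simp: sp measurable_cong_sets[OF sets_iid_samples refl])
  have "(\<integral>\<^sup>+x. ennreal (g x) \<partial>iid_samples M p m) = ennreal (\<integral>x. g x \<partial>iid_samples M p m)"
    using g01 by (intro nn_integral_eq_integral int) (auto simp: sp)
  moreover have "(\<integral>x. g x \<partial>iid_samples M p m) \<le> \<delta>"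
    using ge int by (simp add: prob_space)
  ultimately show ?thesis by (simp add: ennreal_leI)
qed

text \<open>The assumption on \<open>\<gamma>\<close> says exactly that every sparse target
  satisfies the hypothesis of its near half. The two errors and the collision probability would have
  to cover the whole uniform mass, which they cannot.\<close>

lemma not_robustly_testable_half:
  assumes k: "0 < k" and \<gamma>: "\<gamma> * (1 - 1 / sqrt 2) \<le> 1 - 1 / sqrt (2 * real k)"
  shows "\<not> robustly_testable line \<gamma> (half True) (half False)"
proof
  assume "robustly_testable line \<gamma> (half True) (half False)"
  then obtain T where T: "randomized_test line T" and ev: "\<And>\<delta>. \<delta> > 0 \<Longrightarrow> \<exists>m0\<ge>1. \<forall>p\<in>distributions line. \<forall>m\<ge>m0.
         (\<gamma> * hellinger_sq line p (half True) \<le> hellinger_sq line p (half False) \<longrightarrow>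
            prob_output_first line T p m \<ge> 1 - \<delta>) \<and>
         (hellinger_sq line p (half True) \<ge> \<gamma> * hellinger_sq line p (half False) \<longrightarrow>
            prob_output_second line T p m \<ge> 1 - \<delta>)"
    unfolding robustly_testable_def by blast
  \<comment> \<open>The sample bound is uniform in the target, so \<open>m\<close> is fixed first
    and the number of blocks may depend on it.\<close>
  obtain m where m: "1 \<le> m" and test: "\<And>p. p \<in> distributions line \<Longrightarrow>
         (\<gamma> * hellinger_sq line p (half True) \<le> hellinger_sq line p (half False) \<longrightarrow>
            prob_output_first line T p m \<ge> 1 - 1 / 8) \<and>
         (hellinger_sq line p (half True) \<ge> \<gamma> * hellinger_sq line p (half False) \<longrightarrow>
            prob_output_second line T p m \<ge> 1 - 1 / 8)"
    using ev[of "1 / 8"] by auto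
  let ?L = "\<Pi>\<^sub>M i\<in>{..<m}. line"
  have [measurable]: "T m \<in> borel_measurable ?L"
    and T01: "\<And>x. x \<in> space ?L \<Longrightarrow> 0 \<le> T m x \<and> T m x \<le> 1"
    using T m by (auto simp: randomized_test_def)
  \<comment> \<open>Makes the collision bound \<open>m\<^sup>2 / (2 * n)\<close> equal to
    \<open>1 / 4\<close>; with two errors of \<open>1 / 8\<close> the total is \<open>1 / 2\<close>,
    below 1.\<close>
  define n where "n = 2 * m\<^sup>2"
  have n: "0 < n" using m by (simp add: n_def)
  let ?q = "\<lambda>i f. step (n * k) (sparse n k i f)"
  let ?u = "\<lambda>x. \<Prod>l<m. ennreal (unif (x l))"
  let ?I = "\<lambda>x. indicator (- collide n m) x :: ennreal"
  have [measurable]: "unif \<in> borel_measurable line"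
    unfolding unif_eq_step[of 1] by simp
  have one: "(\<integral>\<^sup>+x. ?u x * ?I x * ennreal (T m x) \<partial>?L) \<le> ennreal (1 / 8)"
  proof (rule nn_integral_no_collide_le[where i = True, OF n k])
    fix f assume f: "f \<in> {..<2 * n} \<rightarrow>\<^sub>E {..<k}"
    show "(\<integral>\<^sup>+x. ennreal (T m x) \<partial>iid_samples line (?q True f) m) \<le> ennreal (1 / 8)"
      using test[OF sparse_in_distributions[OF n k f, of True]] T01 \<gamma> hellinger_sq_sparse[OF n k f, of True]
      by (intro nn_integral_error_le sparse_in_distributions[OF n k f]) (auto simp: prob_output_first_def)
  qed simp
  have two: "(\<integral>\<^sup>+x. ?u x * ?I x * ennreal (1 - T m x) \<partial>?L) \<le> ennreal (1 / 8)"
  proof (rule nn_integral_no_collide_le[where i = False, OF n k])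
    fix f assume f: "f \<in> {..<2 * n} \<rightarrow>\<^sub>E {..<k}"
    show "(\<integral>\<^sup>+x. ennreal (1 - T m x) \<partial>iid_samples line (?q False f) m) \<le> ennreal (1 / 8)"
      using test[OF sparse_in_distributions[OF n k f, of False]] T01 \<gamma> hellinger_sq_sparse[OF n k f, of False]
      by (intro nn_integral_error_le sparse_in_distributions[OF n k f]) (auto simp: prob_output_second_def)
  qed simp
  interpret sigma_finite_measure line by (rule sigma_finite_line)
  interpret product_sigma_finite "\<lambda>_::nat. line" by standard
  have "(\<integral>\<^sup>+x. ennreal (unif x) \<partial>line) = 1"
    unfolding unif_eq_step[of 1] by (subst nn_integral_step) auto
  then have "1 = (\<integral>\<^sup>+x. ?u x \<partial>?L)"
    by (subst product_nn_integral_prod) auto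
  \<comment> \<open>Off the collisions the uniform mass is divided between the two outputs of the
    test.\<close>
  also have "\<dots> = (\<integral>\<^sup>+x. ?u x * indicator (collide n m) x
      + (?u x * ?I x * ennreal (T m x) + ?u x * ?I x * ennreal (1 - T m x)) \<partial>?L)"
  proof (intro nn_integral_cong)
    fix x assume "x \<in> space ?L"
    then have "ennreal (T m x) + ennreal (1 - T m x) = 1"
      using T01 by (subst ennreal_plus[symmetric]) auto
    then show "?u x = ?u x * indicator (collide n m) x
      + (?u x * ?I x * ennreal (T m x) + ?u x * ?I x * ennreal (1 - T m x))"
      by (cases "x \<in> collide n m") (auto simp flip: distrib_left)
  qed
  also have "\<dots> = (\<integral>\<^sup>+x. ?u x * indicator (collide n m) x \<partial>?L)
      + ((\<integral>\<^sup>+x. ?u x * ?I x * ennreal (T m x) \<partial>?L) + (\<integral>\<^sup>+x. ?u x * ?I x * ennreal (1 - T m x) \<partial>?L))"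
    by (simp add: nn_integral_add)
  also have "\<dots> \<le> ennreal (real (m\<^sup>2) / real (2 * n)) + (ennreal (1 / 8) + ennreal (1 / 8))"
    by (intro add_mono nn_integral_collide_le n one two)
  also have "\<dots> = ennreal (1 / 2)"
    using m by (simp add: n_def flip: ennreal_plus)
  finally have "ennreal 1 \<le> ennreal (1 / 2)" by (simp only: ennreal_1)
  then show False by (subst (asm) ennreal_le_iff) auto
qed

section \<open>The two hypotheses as a class, and the choice of \<open>k\<close>\<close>

lemma half_in_distributions: "half i \<in> distributions line"
proof -
  have "(\<Sum>j<2 * 1::nat. if j < 1 \<longleftrightarrow> i then 1 else 0) = real 1 * (1 + (0 :: real))"
    by (rule sum_halves)
  then show ?thesis
    using half_eq_step[of 1 1 i] by (auto intro!: step_in_distributions)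
qed

text \<open>The supports are disjoint, so equality at a point forces both values to be 0, against
  total mass 1.\<close>

lemma distinct_distributions_half: "distinct_distributions line (half True) (half False)"
  unfolding distinct_distributions_def
proof
  assume "AE x in line. half True x = half False x"
  then have "AE x in line. half True x = 0"
    by eventually_elim (auto simp: half_def split: if_splits)
  then have "(\<integral>x. half True x \<partial>line) = 0"
    by (rule integral_eq_zero_AE)
  then show False
    using half_in_distributions[of True] by (simp add: distributions_def)
qed

theorem theorem2:
  fixes \<gamma> :: real
  assumes "1 < \<gamma>" and "\<gamma> < sqrt 2 / (sqrt 2 - 1)"
  shows "\<exists>(M :: (nat \<Rightarrow> real) measure) p0 p1.
           is_domain M \<and> p0 \<in> distributions M \<and> p1 \<in> distributions M \<and>
           distinct_distributions M p0 p1 \<and> \<not> robustly_testable M \<gamma> p0 p1"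
proof -
  \<comment> \<open>The threshold equals \<open>1 / (1 - 1 / sqrt 2)\<close>, so
    \<open>\<epsilon>\<close> is the positive slack left for
    \<open>1 / sqrt (2 * k)\<close>.\<close>
  define \<epsilon> where "\<epsilon> = 1 - \<gamma> * (1 - 1 / sqrt 2)"
  have \<epsilon>: "0 < \<epsilon>"
    using assms(2) by (simp add: \<epsilon>_def field_simps)
  obtain k :: nat where k: "(1 / \<epsilon>)\<^sup>2 < real k"
    using reals_Archimedean2 by blast
  have "1 / \<epsilon> \<le> sqrt (2 * real k)"
    using k by (intro real_le_rsqrt) simp
  moreover have "0 < k"
    using k by (metis of_nat_0_less_iff zero_le_power2 order.strict_trans1)
  ultimately have "1 / sqrt (2 * real k) \<le> \<epsilon>"
    using \<epsilon> by (simp add: field_simps)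
  then have "\<not> robustly_testable line \<gamma> (half True) (half False)"
    using \<open>0 < k\<close> by (intro not_robustly_testable_half) (auto simp: \<epsilon>_def)
  moreover have "is_domain line"
  proof -
    have "line = (\<Pi>\<^sub>M i\<in>{..<1}. lborel)"
      by (simp add: line_def lessThan_Suc)
    then show ?thesis unfolding is_domain_def by blast
  qed
  ultimately show ?thesis
    using half_in_distributions distinct_distributions_half by blast
qed

end
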